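(* Let $R_1=0.5828\dots$ be the root in $(0,1)$ of the equation $3y+2\log(1-y)=0$. Then for every $f(x)=\sum_{k=1}^{\infty}x^k a_k\in \mathcal{SRB}(\mathbb{B})$ (with $a_k\in\mathbb{O}$) and every $x\in\mathbb{B}$ with $|x|=r\le R_1$, $$\sum_{k=1}^{\infty}\frac{|x^{k-1} a_k|}{k}\le 1 .$$ The constant $R_1$ cannot be improved, i.e. for every $r\in(R_1,1)$ there exists $f(x)=\sum_{k=1}^{\infty}x^k a_k\in\mathcal{SRB}(\mathbb{B})$ for which this inequality fails for $|x|=r$.
   Context: $\mathbb{O}$ is the real algebra of octonions, $\mathbb{O}=\mathbb{H}+l\mathbb{H}$ ($\mathbb{H}$ the quaternions) with $\overline{a+lb}=\overline a-lb$ and $(a+lb)(c+ld)=(ac-d\overline b)+l(\overline a d+cb)$, a non-commutative, non-associative, alternative division algebra. $|x|=\sqrt{x\overline x}$ is the Euclidean norm on $\mathbb{R}^8$; it is multiplicative. $\mathbb{B}=\{x\in\mathbb{O}:|x|<1\}$, $\mathbb{S}=\{I\in\mathbb{O}:I^2=-1\}$, and $\mathbb{D}$ is the open unit disk of $\mathbb{C}$. Slice regular functions on $\mathbb{B}$: a stem function on $\mathbb{D}$ is $F=F_1+iF_2:\mathbb{D}\to\mathbb{O}\otimes_{\mathbb{R}}\mathbb{C}$ with $\mathbb{O}$-valued components satisfying $F_1(\overline z)=F_1(z)$, $F_2(\overline z)=-F_2(z)$. It induces the slice function $f:\mathbb{B}\to\mathbb{O}$, $f(\alpha+I\beta)=F_1(\alpha+i\beta)+I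 F_2(\alpha+i\beta)$ for $I\in\mathbb{S}$ and real $\alpha,\beta$ with $\alpha+i\beta\in\mathbb{D}$. The function $f$ is slice regular if $F$ is $C^1$ and satisfies the Cauchy–Riemann equations $\partial_\alpha F_1=\partial_\beta F_2$, $\partial_\beta F_1=-\partial_\alpha F_2$ on $\mathbb{D}$. Every slice regular function on $\mathbb{B}$ has a convergent power series expansion $f(x)=\sum_{k=0}^\infty x^k a_k$ with $a_k\in\mathbb{O}$. $\mathcal{SRB}(\mathbb{B})$ is the class of slice regular functions $f$ on $\mathbb{B}$ with $|f(x)|\le 1$ for all $x\in\mathbb{B}$. Convention: $x^0=1$. *)

theory Defs
  imports "HOL-Analysis.Analysis"
begin

text \<open>
  Quaternions are coordinate quadruples with respect to 1, i, j, k, and octonions are pairs of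
  quaternions, (a, b) standing for a + l b.  The vector space structure, topology and norm are those
  of the library's product types; in particular \<^term>\<open>norm\<close> is the Euclidean norm of
  eight-dimensional real space (see \<open>omult_oconj\<close> below).
\<close>

type_synonym quat = "real \<times> real \<times> real \<times> real"
type_synonym octonion = "quat \<times> quat"

fun qmult :: "quat \<Rightarrow> quat \<Rightarrow> quat" where
  "qmult (a1, b1, c1, d1) (a2, b2, c2, d2) =
     (a1 * a2 - b1 * b2 - c1 * c2 - d1 * d2,
      a1 * b2 + b1 * a2 + c1 * d2 - d1 * c2,
      a1 * c2 - b1 * d2 + c1 * a2 + d1 * b2,
      a1 * d2 + b1 * c2 - c1 * b2 + d1 * a2)"

fun qconj :: "quat \<Rightarrow> quat" where
  "qconj (a, b, c, d) = (a, - b, - c, - d)"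

fun omult :: "octonion \<Rightarrow> octonion \<Rightarrow> octonion"  (infixl \<open>\<cdot>\<close> 70) where
  "(a, b) \<cdot> (c, d) =
     (qmult a c - qmult d (qconj b), qmult (qconj a) d + qmult c b)"

fun oconj :: "octonion \<Rightarrow> octonion" where
  "oconj (a, b) = (qconj a, - b)"

definition oone :: octonion where
  "oone = ((1, 0, 0, 0), (0, 0, 0, 0))"

lemma omult_oconj: "x \<cdot> oconj x = (norm x)\<^sup>2 *\<^sub>R oone"
  by (cases x rule: oconj.cases)
     (auto simp: oone_def norm_Pair power2_eq_square algebra_simps)

text \<open>
  The octonions are power associative, so the bracketing in the following definition is
  immaterial.
\<close>

primrec opow :: "octonion \<Rightarrow> nat \<Rightarrow> octonion" where
  "opow x 0 = oone"
| "opow x (Suc n) = x \<cdot> opow x n"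

definition unit_ball :: "octonion set" where
  "unit_ball = {x. norm x < 1}"

definition imag_units :: "octonion set" where
  "imag_units = {I. I \<cdot> I = - oone}"

definition unit_disc :: "complex set" where
  "unit_disc = {z. cmod z < 1}"

definition C1_on :: "('a::real_normed_vector \<Rightarrow> 'b::real_normed_vector) \<Rightarrow> 'a set \<Rightarrow> bool" where
  "C1_on F U \<longleftrightarrow>
     (\<exists>F' :: 'a \<Rightarrow> 'a \<Rightarrow>\<^sub>L 'b.
        (\<forall>z\<in>U. (F has_derivative blinfun_apply (F' z)) (at z)) \<and> continuous_on U F')"

text \<open>
  A stem function F1 + i F2 with values in the complexified octonions is given by its pair of
  octonion-valued components.
\<close>

definition stem_function :: "(complex \<Rightarrow> octonion) \<Rightarrow> (complex \<Rightarrow> octonion) \<Rightarrow> bool" where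
  "stem_function F1 F2 \<longleftrightarrow>
     (\<forall>z\<in>unit_disc. F1 (cnj z) = F1 z \<and> F2 (cnj z) = - F2 z)"

definition induces ::
  "(complex \<Rightarrow> octonion) \<Rightarrow> (complex \<Rightarrow> octonion) \<Rightarrow> (octonion \<Rightarrow> octonion) \<Rightarrow> bool" where
  "induces F1 F2 f \<longleftrightarrow>
     (\<forall>I\<in>imag_units. \<forall>\<alpha> \<beta>. Complex \<alpha> \<beta> \<in> unit_disc \<longrightarrow>
        f (\<alpha> *\<^sub>R oone + \<beta> *\<^sub>R I) = F1 (Complex \<alpha> \<beta>) + I \<cdot> F2 (Complex \<alpha> \<beta>))"

text \<open>
  With z = \<alpha> + i \<beta>, the partial derivatives with respect to \<alpha> and \<beta> are the values of
  the Frechet derivative at the directions 1 and i.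
\<close>

definition cauchy_riemann :: "(complex \<Rightarrow> octonion) \<Rightarrow> (complex \<Rightarrow> octonion) \<Rightarrow> bool" where
  "cauchy_riemann F1 F2 \<longleftrightarrow>
     (\<forall>z\<in>unit_disc.
        frechet_derivative F1 (at z) 1 = frechet_derivative F2 (at z) \<i> \<and>
        frechet_derivative F1 (at z) \<i> = - frechet_derivative F2 (at z) 1)"

text \<open>A function on the unit ball is a total function whose values outside the ball are ignored.\<close>

definition slice_regular :: "(octonion \<Rightarrow> octonion) \<Rightarrow> bool" where
  "slice_regular f \<longleftrightarrow>
     (\<exists>F1 F2. stem_function F1 F2 \<and> induces F1 F2 f \<and>
        C1_on F1 unit_disc \<and> C1_on F2 unit_disc \<and> cauchy_riemann F1 F2)"

definition SRB :: "(octonion \<Rightarrow> octonion) set" where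
  "SRB = {f. slice_regular f \<and> (\<forall>x\<in>unit_ball. norm (f x) \<le> 1)}"

text \<open>
  The expansion of f as the sum over k from 1 of \<open>x\<^sup>k a\<^sub>k\<close>; the summation index is
  shifted by one and the value \<open>a 0\<close> is irrelevant.
\<close>

definition has_expansion :: "(octonion \<Rightarrow> octonion) \<Rightarrow> (nat \<Rightarrow> octonion) \<Rightarrow> bool" where
  "has_expansion f a \<longleftrightarrow>
     (\<forall>x\<in>unit_ball. (\<lambda>k. opow x (Suc k) \<cdot> a (Suc k)) sums f x)"

definition is_R1 :: "real \<Rightarrow> bool" where
  "is_R1 y \<longleftrightarrow> 0 < y \<and> y < 1 \<and> 3 * y + 2 * ln (1 - y) = 0"

definition R1 :: real where
  "R1 = (THE y. is_R1 y)"

end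

theory Submission imports Defs
begin

text \<open>
  Every octonion b lies in a plane spanned by 1 and an imaginary unit I, and on that plane the
  expansion can be averaged over circles like a complex power series.  With the kernel
  \<open>z^(-(n+1)) (1 + b z^n)^2\<close> this gives \<open>|a(n+1) + 2 b a(1)| \<le> 1 + |b|^2\<close>.  Since b is arbitrary, one may take
  \<open>b = a(n+1) conj(a(1)) / |a(n+1)|\<close>, for which \<open>b a(1)\<close> is a nonnegative multiple of \<open>a(n+1)\<close> and
  \<open>|b| = |a(1)|\<close>; hence \<open>|a(n+1)| \<le> 1 - |a(1)|^2\<close>.  With \<open>A = |a(1)|\<close> the sum in question is at most
  \<open>A + (1 - A^2) S(r)\<close>, where \<open>S(r) = (-log(1-r) - r)/r\<close> is increasing, and R1 is the point where
  S takes the value 1/2.  For sharpness at \<open>r > R1\<close>, the function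
  \<open>x (c - x) / (1 - c x)\<close> with \<open>c = R1/r\<close> gives \<open>c + (1 - c^2)/(2c) > 1\<close>.
\<close>

section \<open>Octonion arithmetic: alternativity, conjugation and the multiplicative norm\<close>

lemma octonion_coords:
  fixes x :: octonion
  obtains a b c d e f g h where "x = ((a, b, c, d), (e, f, g, h))"
  by (metis prod.exhaust)

lemma octonion_norm_sq:
  "(norm (((a, b, c, d), (e, f, g, h)) :: octonion))\<^sup>2 =
     a\<^sup>2 + b\<^sup>2 + c\<^sup>2 + d\<^sup>2 + e\<^sup>2 + f\<^sup>2 + g\<^sup>2 + h\<^sup>2"
  by (simp add: norm_Pair)

lemma omult_oone_left [simp]: "oone \<cdot> x = x"
  by (cases x rule: octonion_coords) (simp add: oone_def)

lemma omult_oone_right [simp]: "x \<cdot> oone = x"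
  by (cases x rule: octonion_coords) (simp add: oone_def)

lemma norm_oone [simp]: "norm oone = 1"
  by (simp add: oone_def norm_Pair)

lemma omult_left_alternative: "x \<cdot> (x \<cdot> y) = (x \<cdot> x) \<cdot> y"
  by (cases x rule: octonion_coords; cases y rule: octonion_coords)
    (simp add: algebra_simps)

text \<open>Stands in for associativity in the choice of \<open>b\<close> in
  \<open>coefficient_bound\<close>, where the two coefficients involved need not share a
  slice.\<close>

lemma omult_oconj_cancel: "(x \<cdot> oconj y) \<cdot> y = (norm y)\<^sup>2 *\<^sub>R x"
  by (cases x rule: octonion_coords; cases y rule: octonion_coords)
    (simp add: octonion_norm_sq, simp add: power2_eq_square algebra_simps)

lemma norm_oconj [simp]: "norm (oconj x) = norm x"
  by (cases x rule: octonion_coords) (simp add: norm_Pair)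

lemma oconj_omult_cancel: "oconj x \<cdot> (x \<cdot> y) = (norm x)\<^sup>2 *\<^sub>R y"
  by (cases x rule: octonion_coords; cases y rule: octonion_coords)
    (simp add: octonion_norm_sq, simp add: power2_eq_square algebra_simps)

text \<open>Serves \<open>norm_omult\<close>: moving \<open>x\<close> across the inner product as
  its conjugate turns |x y|^2 into the inner product of \<open>y\<close> with
  \<open>oconj x \<cdot> (x \<cdot> y)\<close>, which \<open>oconj_omult_cancel\<close>
  evaluates.\<close>

lemma inner_omult_left: "inner (x \<cdot> y) z = inner y (oconj x \<cdot> z)"
  by (cases x rule: octonion_coords; cases y rule: octonion_coords; cases z rule: octonion_coords)
    (simp add: inner_prod_def algebra_simps)

lemma norm_omult: "norm (x \<cdot> y) = norm x * norm y"
proof -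
  have "(norm (x \<cdot> y))\<^sup>2 = inner y (oconj x \<cdot> (x \<cdot> y))"
    by (simp only: power2_norm_eq_inner inner_omult_left)
  also have "\<dots> = (norm x * norm y)\<^sup>2"
    by (simp add: oconj_omult_cancel power_mult_distrib flip: power2_norm_eq_inner)
  finally show ?thesis
    by simp
qed

lemma bounded_bilinear_omult: "bounded_bilinear (\<cdot>)"
proof
  fix x x' y y' :: octonion and r :: real
  show "(x + x') \<cdot> y = x \<cdot> y + x' \<cdot> y"
    by (cases x rule: octonion_coords; cases x' rule: octonion_coords; cases y rule: octonion_coords)
      (simp add: algebra_simps)
  show "x \<cdot> (y + y') = x \<cdot> y + x \<cdot> y'"
    by (cases x rule: octonion_coords; cases y rule: octonion_coords; cases y' rule: octonion_coords)
      (simp add: algebra_simps)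
  show "(r *\<^sub>R x) \<cdot> y = r *\<^sub>R (x \<cdot> y)"
    by (cases x rule: octonion_coords; cases y rule: octonion_coords)
      (simp add: algebra_simps)
  show "x \<cdot> (r *\<^sub>R y) = r *\<^sub>R (x \<cdot> y)"
    by (cases x rule: octonion_coords; cases y rule: octonion_coords)
      (simp add: algebra_simps)
  show "\<exists>K. \<forall>x y. norm (x \<cdot> y) \<le> norm x * norm y * K"
    by (rule exI[of _ 1]) (simp add: norm_omult)
qed

interpretation omult: bounded_bilinear "(\<cdot>)"
  by (rule bounded_bilinear_omult)

lemma norm_opow: "norm (opow x n) = norm x ^ n"
  by (induction n) (auto simp: norm_omult)

section \<open>Slices: complex planes through the real axis\<close>

text \<open>
  By alternativity, left multiplication by the plane spanned by 1 and I makes the octonions a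
  complex vector space (\<open>slice_mult\<close> below), which is all the associativity that is needed.
\<close>

definition slice :: "octonion \<Rightarrow> complex \<Rightarrow> octonion" where
  "slice I z = Re z *\<^sub>R oone + Im z *\<^sub>R I"

lemma bounded_linear_slice: "bounded_linear (slice I)"
  unfolding slice_def
  by (intro bounded_linear_add bounded_linear_scaleR_const bounded_linear_Re bounded_linear_Im)

lemmas slice_linear_simps = linear_simps[OF bounded_linear_slice]

lemma slice_of_real [simp]: "slice I (of_real r) = r *\<^sub>R oone"
  by (simp add: slice_def)

lemma slice_mult:
  assumes "I \<in> imag_units"
  shows "slice I (z * w) \<cdot> y = slice I z \<cdot> (slice I w \<cdot> y)"
proof -
  have "I \<cdot> (I \<cdot> y) = - y"
    using assms by (simp add: omult_left_alternative imag_units_def omult.minus_left)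
  then show ?thesis
    by (simp add: slice_def omult.add_left omult.add_right omult.scaleR_left omult.scaleR_right
        omult.diff_left algebra_simps)
qed

lemma opow_slice:
  assumes "I \<in> imag_units"
  shows "opow (slice I z) n = slice I (z ^ n)"
proof (induction n)
  case 0
  then show ?case by (simp add: slice_def)
next
  case (Suc n)
  then show ?case
    using slice_mult[OF assms, of z "z ^ n" oone] by simp
qed

text \<open>Write I = a + v with \<open>a\<close> real, v purely imaginary and s = |v|^2; then I^2 =
  a^2 - s + 2 a v. If \<open>a\<close> were nonzero, v would vanish and a^2 = -1, which is
  impossible; so a = 0 and s = 1.\<close>

lemma imag_units_iff: "I \<in> imag_units \<longleftrightarrow> fst (fst I) = 0 \<and> norm I = 1"
proof -
  obtain a b c d e f g h where I: "I = ((a, b, c, d), (e, f, g, h))"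
    by (rule octonion_coords)
  define s where "s = b\<^sup>2 + c\<^sup>2 + d\<^sup>2 + e\<^sup>2 + f\<^sup>2 + g\<^sup>2 + h\<^sup>2"
  have sq: "I \<cdot> I = ((a\<^sup>2 - s, 2*a*b, 2*a*c, 2*a*d), (2*a*e, 2*a*f, 2*a*g, 2*a*h))"
    by (simp add: I s_def power2_eq_square algebra_simps)
  have n: "norm I = 1 \<longleftrightarrow> a\<^sup>2 + s = 1"
  proof -
    have "norm I = 1 \<longleftrightarrow> (norm I)\<^sup>2 = 1"
      using norm_ge_zero[of I] unfolding power2_eq_1_iff by linarith
    then show ?thesis
      unfolding I octonion_norm_sq s_def by (simp add: add.assoc)
  qed
  show ?thesis
  proof
    assume "I \<in> imag_units"
    then have *: "a\<^sup>2 - s = -1" "a*b = 0" "a*c = 0" "a*d = 0" "a*e = 0" "a*f = 0" "a*g = 0" "a*h = 0"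
      by (auto simp: imag_units_def sq oone_def)
    have "a = 0"
    proof (rule ccontr)
      assume "a \<noteq> 0"
      with * have "s = 0" by (simp add: s_def)
      with * have "a\<^sup>2 = -1" by simp
      then show False by (metis neg_0_le_iff_le not_one_le_zero zero_le_power2)
    qed
    then show "fst (fst I) = 0 \<and> norm I = 1"
      using * n by (simp add: I)
  next
    assume *: "fst (fst I) = 0 \<and> norm I = 1"
    then have "a = 0"
      by (simp add: I)
    moreover have "s = 1"
      using * n \<open>a = 0\<close> by simp
    ultimately show "I \<in> imag_units"
      by (simp add: imag_units_def sq oone_def zero_prod_def)
  qed
qed

lemma norm_slice:
  assumes "I \<in> imag_units"
  shows "norm (slice I z) = norm z"
proof -
  have I: "fst (fst I) = 0" "norm I = 1"
    using assms by (auto simp: imag_units_iff)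
  have "inner oone I = 0"
    using I by (cases I rule: octonion_coords) (simp add: oone_def inner_prod_def)
  then have "(norm (slice I z))\<^sup>2 = (Re z)\<^sup>2 + (Im z)\<^sup>2"
    using I norm_add_Pythagorean[of "Re z *\<^sub>R oone" "Im z *\<^sub>R I"]
    by (simp add: slice_def orthogonal_def)
  then show ?thesis
    by (simp add: cmod_def real_sqrt_unique)
qed

lemma slice_exhaust:
  obtains I z where "I \<in> imag_units" "x = slice I z"
proof -
  obtain a b c d e f g h where x: "x = ((a, b, c, d), (e, f, g, h))"
    by (rule octonion_coords)
  define v :: octonion where "v = ((0, b, c, d), (e, f, g, h))"
  have xv: "x = a *\<^sub>R oone + v"
    by (simp add: x v_def oone_def)
  show ?thesis
  proof (cases "v = 0")
    case True
    \<comment> \<open>A real octonion lies in every slice; the quaternion unit i is picked.\<close>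
    have "((0, 1, 0, 0), 0) \<in> imag_units"
      by (simp add: imag_units_iff norm_Pair)
    moreover have "x = slice ((0, 1, 0, 0), 0) (of_real a)"
      using xv True by simp
    ultimately show ?thesis by (rule that)
  next
    case False
    then have "v /\<^sub>R norm v \<in> imag_units"
      by (simp add: imag_units_iff) (simp add: v_def)
    moreover have "x = slice (v /\<^sub>R norm v) (Complex a (norm v))"
      using xv False by (simp add: slice_def)
    ultimately show ?thesis by (rule that)
  qed
qed

section \<open>Averaging over roots of unity\<close>

text \<open>This is a geometric sum with ratio w^s, w a primitive N-th root of unity. The ratio is 1
  exactly when N divides s; otherwise the sum vanishes because the N-th power of the ratio is
  1.\<close>

lemma sum_root_unity_powers:
  assumes "0 < N"
  shows "(\<Sum>j<N. (cis (2 * pi / real N) ^ j) ^ s) = (if N dvd s then of_nat N else 0)"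
proof -
  let ?w = "cis (2 * pi / real N)"
  have wN: "?w ^ N = 1"
    using assms by (simp add: Complex.DeMoivre)
  have one_iff: "?w ^ s = 1 \<longleftrightarrow> N dvd s"
  proof
    assume "?w ^ s = 1"
    then have "cos (real s * (2 * pi / real N)) = 1"
      by (auto simp: Complex.DeMoivre complex_eq_iff)
    then obtain k :: int where "real s * (2 * pi / real N) = of_int k * 2 * pi"
      by (auto simp: cos_one_2pi_int)
    then have "real s = of_int k * real N"
      using assms by (simp add: field_simps)
    then have "int s = k * int N"
      by (metis of_int_eq_iff of_int_mult of_int_of_nat_eq)
    then show "N dvd s"
      by (metis dvd_triv_right int_dvd_int_iff)
  next
    assume "N dvd s"
    then show "?w ^ s = 1"
      using wN by (auto simp: power_mult)
  qed
  have "(\<Sum>j<N. (?w ^ j) ^ s) = (\<Sum>j<N. (?w ^ s) ^ j)"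
    by (simp add: mult.commute flip: power_mult)
  also have "\<dots> = (if N dvd s then of_nat N else 0)"
  proof (cases "N dvd s")
    case False
    have "(?w ^ s) ^ N = 1"
      using wN by (metis mult.commute power_mult power_one)
    then show ?thesis
      using False one_iff by (simp add: sum_gp_strict)
  qed (use one_iff in simp)
  finally show ?thesis .
qed

lemma mult_power_shift: "(x :: 'a :: comm_semiring_1) ^ p * (r * x) ^ q = r ^ q * x ^ (p + q)"
  by (simp add: power_mult_distrib power_add mult_ac)

text \<open>
  Average the polynomial on the circle of radius r against the weights
  \<open>u^(-(n+1)) (1 + w u^n)^2\<close> over N-th roots of unity u.  For large N only the coefficients with
  indices n + 1 and 1 survive, and the moduli of the weights average to \<open>1 + |w|^2\<close>.
\<close>

lemma polynomial_coefficient_bound: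
  fixes c :: "nat \<Rightarrow> octonion"
  assumes I: "I \<in> imag_units" and n: "0 < n" "n < M" and r: "0 \<le> r"
    and bound: "\<And>z. norm z = r \<Longrightarrow> norm (\<Sum>k<M. slice I (z ^ Suc k) \<cdot> c k) \<le> B"
  shows "norm (r ^ Suc n *\<^sub>R c n + slice I (2 * w * of_real r) \<cdot> c 0) \<le> B * (1 + (norm w)\<^sup>2)"
proof -
  \<comment> \<open>Since u^N = 1, the exponent N - n - 1 = M represents -(n + 1) as a natural
    number. Also n + k < N for all k < M, so no higher index is aliased onto the two wanted
    ones.\<close>
  define N where "N = M + n + 1"
  define u where "u = (\<lambda>j. cis (2 * pi / real N) ^ j)"
  define W where "W = (\<lambda>j. u j ^ (N - n - 1) * (1 + w * u j ^ n)\<^sup>2)"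
  define P where "P = (\<lambda>z. \<Sum>k<M. slice I (z ^ Suc k) \<cdot> c k)"
  have N: "0 < N" by (simp add: N_def)
  have norm_u: "norm (u j) = 1" for j
    by (simp add: u_def norm_power)
  have u_sum: "(\<Sum>j<N. u j ^ s) = (if N dvd s then of_nat N else 0)" for s
    using sum_root_unity_powers[OF N] by (simp add: u_def)
  have Wk: "W j * (of_real r * u j) ^ Suc k = of_real r ^ Suc k *
      (u j ^ (N + k - n) + 2 * w * u j ^ (N + k) + w\<^sup>2 * u j ^ (N + n + k))" for j k
  proof -
    have *: "N - n - 1 + Suc k = N + k - n" "N - n - 1 + n + Suc k = N + k"
      "N - n - 1 + n + n + Suc k = N + n + k"
      by (auto simp: N_def)
    have "W j = u j ^ (N - n - 1) + 2 * w * u j ^ (N - n - 1 + n) + w\<^sup>2 * u j ^ (N - n - 1 + n + n)"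
      by (simp add: W_def power2_eq_square algebra_simps power_add)
    then have "W j * (of_real r * u j) ^ Suc k = of_real r ^ Suc k *
      (u j ^ (N - n - 1 + Suc k) + 2 * w * u j ^ (N - n - 1 + n + Suc k)
        + w\<^sup>2 * u j ^ (N - n - 1 + n + n + Suc k))"
      by (simp only: distrib_right distrib_left mult.assoc mult_power_shift) (simp add: mult_ac)
    then show ?thesis
      by (simp only: *)
  qed
  have Wsum: "(\<Sum>j<N. W j * (of_real r * u j) ^ Suc k) =
      of_nat N * (if k = n then of_real r ^ Suc n else if k = 0 then 2 * w * of_real r else 0)"
    if "k < M" for k
  proof -
    \<comment> \<open>The number N + k - n lies strictly between 0 and 2 N, so N is its only
      possible value among the multiples of N.\<close>
    have d1: "N dvd N + k - n \<longleftrightarrow> k = n"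
    proof
      assume "N dvd N + k - n"
      then obtain q where q: "N + k - n = N * q" by blast
      have "q \<noteq> 0" using q that n by (intro notI) (simp add: N_def)
      moreover have "q < 2"
      proof (rule ccontr)
        assume "\<not> q < 2"
        then have "N * 2 \<le> N * q" by simp
        then show False using q that by (simp add: N_def)
      qed
      ultimately have "q = 1" by simp
      then show "k = n" using q that by (simp add: N_def)
    qed simp
    have d2: "N dvd N + k \<longleftrightarrow> k = 0"
    proof -
      have "N dvd N + k \<longleftrightarrow> N dvd k"
        by simp
      then show ?thesis
        using that by (auto simp: N_def dest: dvd_imp_le)
    qed
    have d3: "\<not> N dvd N + n + k"
    proof -
      have "N dvd N + n + k \<longleftrightarrow> N dvd n + k"
        by (simp add: add.assoc)
      then show ?thesis
        using that n by (auto simp: N_def dest: dvd_imp_le)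
    qed
    have "(\<Sum>j<N. W j * (of_real r * u j) ^ Suc k) = of_real r ^ Suc k *
       ((\<Sum>j<N. u j ^ (N + k - n)) + 2 * w * (\<Sum>j<N. u j ^ (N + k))
         + w\<^sup>2 * (\<Sum>j<N. u j ^ (N + n + k)))"
      by (simp only: Wk sum.distrib flip: sum_distrib_left)
    then show ?thesis
      using n by (simp only: u_sum d1 d2 d3) auto
  qed
  \<comment> \<open>By \<open>slice_mult\<close> the weights merge with the powers of z inside the
    slice, so the averaging happens in the complex numbers before any multiplication by
    \<open>c k\<close>.\<close>
  have "(\<Sum>j<N. slice I (W j) \<cdot> P (of_real r * u j)) =
      (\<Sum>k<M. slice I (\<Sum>j<N. W j * (of_real r * u j) ^ Suc k) \<cdot> c k)"
    by (simp add: P_def omult.sum_right omult.sum_left slice_mult[OF I] sum.swap[of _ "{..<M}"]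
        bounded_linear.linear[OF bounded_linear_slice] linear_sum del: power_Suc)
  also have "\<dots> = (\<Sum>k<M. real N *\<^sub>R ((if k = n then r ^ Suc n *\<^sub>R c n else 0) +
      (if k = 0 then slice I (2 * w * of_real r) \<cdot> c 0 else 0)))"
  proof (rule sum.cong)
    fix k assume "k \<in> {..<M}"
    then have "(\<Sum>j<N. W j * (of_real r * u j) ^ Suc k) = real N *\<^sub>R
        (if k = n then of_real (r ^ Suc n) else if k = 0 then 2 * w * of_real r else 0)"
      by (simp add: Wsum scaleR_conv_of_real del: power_Suc)
    then show "slice I (\<Sum>j<N. W j * (of_real r * u j) ^ Suc k) \<cdot> c k = real N *\<^sub>R
      ((if k = n then r ^ Suc n *\<^sub>R c n else 0) +
      (if k = 0 then slice I (2 * w * of_real r) \<cdot> c 0 else 0))"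
      using n by (simp add: omult.scaleR_left omult.zero_left slice_linear_simps del: power_Suc of_real_power)
  qed simp
  also have "\<dots> = real N *\<^sub>R (r ^ Suc n *\<^sub>R c n + slice I (2 * w * of_real r) \<cdot> c 0)"
    using n by (simp add: sum.distrib flip: scaleR_sum_right)
  finally have eq: "(\<Sum>j<N. slice I (W j) \<cdot> P (of_real r * u j)) =
      real N *\<^sub>R (r ^ Suc n *\<^sub>R c n + slice I (2 * w * of_real r) \<cdot> c 0)" .

  \<comment> \<open>The squared factor in \<open>W\<close> has modulus |1 + w u^n|^2, whose cross
    term averages to zero because N does not divide n.\<close>
  have nW: "norm (W j) = 1 + (norm w)\<^sup>2 + 2 * Re (w * u j ^ n)" for j
  proof -
    have "norm (W j) = (norm (1 + w * u j ^ n))\<^sup>2"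
      by (simp add: W_def norm_mult norm_power norm_u)
    also have "\<dots> = 1 + (norm (w * u j ^ n))\<^sup>2 + 2 * Re (w * u j ^ n)"
      unfolding cmod_power2 by (simp add: power2_eq_square algebra_simps)
    finally show ?thesis by (simp add: norm_mult norm_power norm_u)
  qed
  have "\<not> N dvd n"
    using n by (auto simp: N_def dest: dvd_imp_le)
  then have Re_sum_0: "(\<Sum>j<N. Re (w * u j ^ n)) = 0"
    using u_sum[of n] by (simp only: if_False mult_zero_right zero_complex.simps
        flip: Re_sum sum_distrib_left)
  then have W_total: "(\<Sum>j<N. norm (W j)) = real N * (1 + (norm w)\<^sup>2)"
    by (simp only: nW sum.distrib Re_sum_0 flip: sum_distrib_left)
      (simp add: distrib_left)
  have "norm (\<Sum>j<N. slice I (W j) \<cdot> P (of_real r * u j)) \<le> (\<Sum>j<N. norm (W j) * B)"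
  proof (rule sum_norm_le)
    fix j
    have "norm (P (of_real r * u j)) \<le> B"
      unfolding P_def by (rule bound) (simp add: norm_mult norm_u r)
    then show "norm (slice I (W j) \<cdot> P (of_real r * u j)) \<le> norm (W j) * B"
      by (simp add: norm_omult norm_slice[OF I] mult_left_mono)
  qed
  also have "\<dots> = real N * (B * (1 + (norm w)\<^sup>2))"
    unfolding sum_distrib_right[symmetric] W_total by simp
  finally show ?thesis
    unfolding eq using N by (simp del: power_Suc)
qed

section \<open>Coefficient estimates for bounded expansions\<close>

text \<open>Convergence at a real point s between r and 1 bounds the terms there; Abel's lemma then
  dominates the terms at r by a geometric series.\<close>

lemma expansion_terms_summable:
  assumes exp: "has_expansion f a" and r: "0 \<le> r" "r < 1"
  shows "summable (\<lambda>k. r ^ Suc k * norm (a (Suc k)))"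
proof -
  define s where "s = (1 + r) / 2"
  have s: "r < s" "0 < s" "s < 1"
    using r by (auto simp: s_def)
  have "s *\<^sub>R oone \<in> unit_ball"
    using s by (simp add: unit_ball_def)
  then have "summable (\<lambda>k. opow (s *\<^sub>R oone) (Suc k) \<cdot> a (Suc k))"
    using exp by (auto simp: has_expansion_def sums_iff)
  then have "Bseq (\<lambda>k. opow (s *\<^sub>R oone) (Suc k) \<cdot> a (Suc k))"
    by (auto intro: convergent_imp_Bseq convergentI dest: summable_LIMSEQ_zero)
  then obtain K where K: "\<And>k. norm (opow (s *\<^sub>R oone) (Suc k) \<cdot> a (Suc k)) \<le> K"
    by (auto simp: Bseq_def)
  \<comment> \<open>The expansion starts at exponent 1: one factor s is absorbed into the
    coefficient to match Abel's lemma and is exchanged for r at the end.\<close>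
  have "summable (\<lambda>k. norm (s *\<^sub>R a (Suc k)) * r ^ k)"
  proof (rule Abel_lemma)
    fix k
    show "norm (s *\<^sub>R a (Suc k)) * s ^ k \<le> K"
      using K[of k] s by (simp add: norm_omult norm_opow mult_ac)
  qed (use r s in auto)
  from summable_mult[OF this, of "r / s"] show ?thesis
    using s by (simp add: mult_ac)
qed

lemma coefficient_inequality:
  assumes exp: "has_expansion f a" and bound: "\<And>x. x \<in> unit_ball \<Longrightarrow> norm (f x) \<le> 1"
    and n: "0 < n"
  shows "norm (a (Suc n) + 2 *\<^sub>R (b \<cdot> a 1)) \<le> 1 + (norm b)\<^sup>2"
proof -
  \<comment> \<open>The slice is chosen to contain \<open>b\<close>, so that the kernel weight and
    the circle of averaging lie in the same plane, where \<open>slice_mult\<close> applies.\<close>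
  obtain I w where I: "I \<in> imag_units" and b: "b = slice I w"
    by (rule slice_exhaust)
  \<comment> \<open>The finite average needs a polynomial, so the series is truncated. On |z| = r
    the tail is at most \<open>e\<close> uniformly, since its majorant depends only on r.\<close>
  have approx: "norm (r ^ Suc n *\<^sub>R a (Suc n) + slice I (2 * w * of_real r) \<cdot> a 1)
      \<le> (1 + e) * (1 + (norm w)\<^sup>2)"
    if r: "0 < r" "r < 1" and e: "0 < e" for r e
  proof -
    have sm: "summable (\<lambda>k. r ^ Suc k * norm (a (Suc k)))"
      using expansion_terms_summable[OF exp] r by simp
    obtain M0 where M0: "\<And>m. m \<ge> M0 \<Longrightarrow> norm (\<Sum>k. r ^ Suc (k + m) * norm (a (Suc (k + m)))) < e"
      using suminf_exist_split[OF e sm] by blast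
    \<comment> \<open>Taking M > n keeps \<open>a (Suc n)\<close> among the retained terms.\<close>
    define M where "M = max M0 (Suc n)"
    have "norm (\<Sum>k<M. slice I (z ^ Suc k) \<cdot> a (Suc k)) \<le> 1 + e" if z: "norm z = r" for z
    proof -
      define t where "t = (\<lambda>k. slice I (z ^ Suc k) \<cdot> a (Suc k))"
      have nt: "norm (t k) = r ^ Suc k * norm (a (Suc k))" for k
        unfolding t_def norm_omult norm_slice[OF I] norm_power z ..
      have z_ball: "slice I z \<in> unit_ball"
        using r z by (simp add: unit_ball_def norm_slice[OF I])
      then have t: "t sums f (slice I z)"
        using exp by (auto simp: has_expansion_def t_def opow_slice[OF I] simp del: opow.simps power_Suc)
      have nt_sm: "summable (\<lambda>k. norm (t (k + M)))"
        unfolding nt using sm by (rule summable_ignore_initial_segment)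
      have "(\<Sum>k<M. t k) = f (slice I z) - (\<Sum>k. t (k + M))"
        using suminf_minus_initial_segment[of t M] t by (auto simp: sums_iff)
      also have "norm \<dots> \<le> norm (f (slice I z)) + norm (\<Sum>k. t (k + M))"
        by (rule norm_triangle_ineq4)
      also have "norm (\<Sum>k. t (k + M)) \<le> (\<Sum>k. norm (t (k + M)))"
        by (rule summable_norm[OF nt_sm])
      also have "\<dots> \<le> e"
        using M0[of M] unfolding nt by (auto simp: M_def simp del: power_Suc)
      finally show ?thesis
        using bound[OF z_ball] by (simp add: t_def)
    qed
    then show ?thesis
      using polynomial_coefficient_bound[OF I n, of M r "\<lambda>k. a (Suc k)" "1 + e" w] r
      by (simp add: M_def del: power_Suc)
  qed
  have main: "norm (r ^ Suc n *\<^sub>R a (Suc n) + slice I (2 * w * of_real r) \<cdot> a 1)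
      \<le> 1 + (norm w)\<^sup>2" if r: "0 < r" "r < 1" for r
  proof (rule field_le_epsilon)
    fix e :: real assume e: "0 < e"
    have p: "0 < 1 + (norm w)\<^sup>2"
      by (simp add: add_pos_nonneg)
    have "(1 + e / (1 + (norm w)\<^sup>2)) * (1 + (norm w)\<^sup>2) = 1 + (norm w)\<^sup>2 + e"
      using p by (simp add: field_simps)
    then show "norm (r ^ Suc n *\<^sub>R a (Suc n) + slice I (2 * w * of_real r) \<cdot> a 1)
        \<le> 1 + (norm w)\<^sup>2 + e"
      using approx[OF r, of "e / (1 + (norm w)\<^sup>2)"] e p by simp
  qed
  have "((\<lambda>r. norm (r ^ Suc n *\<^sub>R a (Suc n) + slice I (2 * w * of_real r) \<cdot> a 1)) \<longlongrightarrow>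
      norm (1 ^ Suc n *\<^sub>R a (Suc n) + slice I (2 * w * of_real 1) \<cdot> a 1)) (at_left (1::real))"
    by (intro tendsto_intros omult.tendsto bounded_linear.tendsto[OF bounded_linear_slice])
  moreover have "eventually (\<lambda>r. norm (r ^ Suc n *\<^sub>R a (Suc n) + slice I (2 * w * of_real r) \<cdot> a 1)
      \<le> 1 + (norm w)\<^sup>2) (at_left (1::real))"
    using eventually_at_left_real[of 0 "1::real"] by (auto elim!: eventually_mono intro!: main simp del: power_Suc One_nat_def)
  ultimately have "norm (a (Suc n) + slice I (2 * w) \<cdot> a 1) \<le> 1 + (norm w)\<^sup>2"
    using tendsto_upperbound trivial_limit_at_left_real by force
  moreover have "slice I (2 * w) \<cdot> a 1 = 2 *\<^sub>R (b \<cdot> a 1)"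
    by (simp add: slice_def b omult.add_left omult.scaleR_left algebra_simps)
  ultimately show ?thesis
    by (simp add: b norm_slice[OF I])
qed

text \<open>Octonionic form of Wiener's estimate |c_n| \<le> 1 - |c_0|^2 for functions bounded by 1;
  the index is shifted because f vanishes at the origin.\<close>

lemma coefficient_bound:
  assumes "has_expansion f a" and "\<And>x. x \<in> unit_ball \<Longrightarrow> norm (f x) \<le> 1" and "0 < n"
  shows "norm (a (Suc n)) \<le> 1 - (norm (a 1))\<^sup>2"
proof -
  have ineq: "norm (a (Suc n) + 2 *\<^sub>R (b \<cdot> a 1)) \<le> 1 + (norm b)\<^sup>2" for b
    using coefficient_inequality assms by blast
  define c where "c = a (Suc n)"
  show ?thesis
  proof (cases "c = 0")
    case True
    \<comment> \<open>Only |a 1| \<le> 1 remains: b = |a 1| gives 2 |a 1|^2 \<le> 1 + |a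
      1|^2.\<close>
    then show ?thesis
      using ineq[of "norm (a 1) *\<^sub>R oone"]
      by (simp add: c_def omult.scaleR_left power2_eq_square)
  next
    case False
    define b where "b = (1 / norm c) *\<^sub>R (c \<cdot> oconj (a 1))"
    have b: "norm b = norm (a 1)"
      using False by (simp add: b_def norm_omult)
    \<comment> \<open>Both summands are nonnegative multiples of \<open>c\<close>, so no
      cancellation occurs and their norms add.\<close>
    have "c + 2 *\<^sub>R (b \<cdot> a 1) = (1 + 2 * (norm (a 1))\<^sup>2 / norm c) *\<^sub>R c"
      by (simp add: b_def omult.scaleR_left omult_oconj_cancel scaleR_add_left)
    then have "norm (c + 2 *\<^sub>R (b \<cdot> a 1)) = (1 + 2 * (norm (a 1))\<^sup>2 / norm c) * norm c"
      by (simp add: add_nonneg_nonneg)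
    also have "\<dots> = norm c + 2 * (norm (a 1))\<^sup>2"
      using False by (simp add: field_simps)
    finally show ?thesis
      using ineq[of b] b by (simp add: c_def)
  qed
qed

section \<open>The logarithmic remainder and the constant R1\<close>

lemma log_remainder_sums:
  fixes t :: real
  assumes "0 < t" "t < 1"
  shows "(\<lambda>k. t ^ Suc k / real (k + 2)) sums ((- ln (1 - t) - t) / t)"
proof -
  \<comment> \<open>The term at n = 0 is a division by zero and hence 0. Dropping the terms n = 0
    and n = 1 therefore adds exactly t to the sum.\<close>
  have "(\<lambda>n. - (t ^ n) / real n) sums ln (1 - t)"
    using ln_series'[of "- t"] assms by simp
  from sums_split_initial_segment[OF this, of 2]
  have "(\<lambda>n. - (t ^ (n + 2)) / real (n + 2)) sums (ln (1 - t) + t)"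
    by (simp add: numeral_2_eq_2)
  from sums_mult[OF this, of "- (1 / t)"]
  have "(\<lambda>n. - (1 / t) * (- (t ^ (n + 2)) / real (n + 2))) sums (- (1 / t) * (ln (1 - t) + t))" .
  moreover have "(\<lambda>n. - (1 / t) * (- (t ^ (n + 2)) / real (n + 2))) = (\<lambda>k. t ^ Suc k / real (k + 2))"
    using assms by (simp add: fun_eq_iff)
  moreover have "- (1 / t) * (ln (1 - t) + t) = (- ln (1 - t) - t) / t"
    by (simp add: diff_divide_distrib add_divide_distrib)
  ultimately show ?thesis
    by metis
qed

text \<open>Every power in the series has exponent at least 1, so S(s) \<le> (s/t) S(t) termwise;
  strictness comes from S(t) > 0.\<close>

lemma log_remainder_strict_mono:
  fixes s t :: real
  assumes "0 < s" "s < t" "t < 1"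
  shows "(- ln (1 - s) - s) / s < (- ln (1 - t) - t) / t" (is "?S s < ?S t")
proof -
  have t: "(\<lambda>k. t ^ Suc k / real (k + 2)) sums ?S t"
    using assms by (intro log_remainder_sums) auto
  have "0 < (\<Sum>k. t ^ Suc k / real (k + 2))"
    using t assms by (intro suminf_pos) (auto simp: sums_iff)
  then have pos: "0 < ?S t"
    using t by (simp add: sums_iff)
  have "s ^ Suc k / real (k + 2) \<le> s / t * (t ^ Suc k / real (k + 2))" for k
  proof -
    have "s ^ k \<le> t ^ k"
      using assms by (intro power_mono) auto
    then show ?thesis
      using assms by (simp add: divide_right_mono mult_left_mono)
  qed
  then have "?S s \<le> s / t * ?S t"
    using assms by (intro sums_le[OF _ log_remainder_sums sums_mult[OF t]]) auto
  also have "\<dots> < ?S t"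
    using pos assms mult_strict_right_mono[of "s / t" 1 "?S t"] by simp
  finally show ?thesis .
qed

text \<open>Dividing the defining equation by 2 y exhibits the root as a level point of the strictly
  increasing remainder, whence uniqueness.\<close>

lemma is_R1_iff: "is_R1 y \<longleftrightarrow> 0 < y \<and> y < 1 \<and> (- ln (1 - y) - y) / y = 1 / 2"
  by (auto simp: is_R1_def field_simps)

lemma is_R1_unique:
  assumes "is_R1 y" "is_R1 z"
  shows "y = z"
proof (rule linorder_cases[of y z])
  assume "y < z"
  then show ?thesis
    using log_remainder_strict_mono[of y z] assms unfolding is_R1_iff by linarith
next
  assume "z < y"
  then show ?thesis
    using log_remainder_strict_mono[of z y] assms unfolding is_R1_iff by linarith
qed

text \<open>The number 12/5 is close to 1/(1 - R1), so that linear estimates cover the remaining factor.\<close>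

lemma ln_12_over_5_bounds: "ln (12 / 5 :: real) \<in> {0.8754<..<0.87547}"
  using ln_approx_bounds[of "12 / 5" 5] by (simp add: eval_nat_numeral)

lemma ln_lower_endpoint: "0 < 3 * 0.5828 + 2 * ln (1 - 0.5828 :: real)"
proof -
  have "ln (12 / 5 * 0.4172 :: real) = ln (12 / 5) + ln 0.4172"
    by (rule ln_mult_pos) auto
  \<comment> \<open>The product is 1.00128; the bound is ln v \<le> v - 1 applied to its
    reciprocal.\<close>
  moreover have "ln (12 / 5 * 0.4172 :: real) \<ge> 1 - 1 / (12 / 5 * 0.4172)"
    using ln_le_minus_one[of "1 / (12 / 5 * 0.4172 :: real)"] by (simp add: ln_div)
  ultimately show ?thesis
    using ln_12_over_5_bounds by simp
qed

lemma ln_upper_endpoint: "3 * 0.5829 + 2 * ln (1 - 0.5829 :: real) < 0"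
proof -
  have "ln (12 / 5 * 0.4171 :: real) = ln (12 / 5) + ln 0.4171"
    by (rule ln_mult_pos) auto
  moreover have "ln (12 / 5 * 0.4171 :: real) \<le> 12 / 5 * 0.4171 - 1"
    by (rule ln_le_minus_one) simp
  ultimately show ?thesis
    using ln_12_over_5_bounds by simp
qed

lemma R1_exists: obtains y where "is_R1 y" "0.5828 < y" "y < 0.5829"
proof -
  have "\<exists>y. 0.5828 \<le> y \<and> y \<le> 0.5829 \<and> 3 * y + 2 * ln (1 - y) = (0 :: real)"
  proof (rule IVT2')
    show "continuous_on {0.5828..0.5829} (\<lambda>y::real. 3 * y + 2 * ln (1 - y))"
      by (intro continuous_intros) auto
  qed (use ln_lower_endpoint ln_upper_endpoint in auto)
  then obtain y :: real where y: "0.5828 \<le> y" "y \<le> 0.5829" "3 * y + 2 * ln (1 - y) = 0"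
    by blast
  then have "y \<noteq> 0.5828" "y \<noteq> 0.5829"
    using y(3) ln_lower_endpoint ln_upper_endpoint by (metis less_irrefl)+
  with y show ?thesis
    by (intro that) (auto simp: is_R1_def)
qed

lemma is_R1_R1: "is_R1 R1"
  unfolding R1_def using R1_exists is_R1_unique by (metis theI)

lemma R1_bounds: "0.5828 < R1" "R1 < 0.5829"
  using R1_exists is_R1_unique[OF is_R1_R1] by metis+

lemma R1_remainder_sums: "(\<lambda>k. R1 ^ Suc k / real (k + 2)) sums (1 / 2)"
proof -
  have "0 < R1" "R1 < 1" "(- ln (1 - R1) - R1) / R1 = 1 / 2"
    using is_R1_R1 unfolding is_R1_iff by blast+
  then show ?thesis
    using log_remainder_sums[of R1] by (simp only:)
qed

text \<open>Termwise comparison with the series at \<open>R1\<close> also covers r = 0, where the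
  closed form would divide by zero.\<close>

lemma remainder_le_half:
  assumes "0 \<le> r" "r \<le> R1"
  shows "summable (\<lambda>k. r ^ Suc k / real (k + 2))" (is "summable ?g")
    and "(\<Sum>k. r ^ Suc k / real (k + 2)) \<le> 1 / 2"
proof -
  let ?G = "\<lambda>k. R1 ^ Suc k / real (k + 2)"
  have G: "summable ?G" "suminf ?G = 1 / 2"
    using R1_remainder_sums by (auto simp only: sums_iff)
  have le: "?g k \<le> ?G k" for k
    by (rule divide_right_mono[OF power_mono[OF assms(2,1)]]) simp
  show *: "summable ?g"
  proof (rule summable_comparison_test'[OF G(1)])
    fix k
    have "norm (?g k) = ?g k"
      using assms by simp
    then show "norm (?g k) \<le> ?G k"
      using le[of k] by (simp only:)
  qed
  show "suminf ?g \<le> 1 / 2"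
    using suminf_le[OF le * G(1)] unfolding G(2) .
qed

section \<open>The inequality up to radius R1\<close>

lemma Bohr_sum_le_one:
  assumes "f \<in> SRB" "has_expansion f a" "norm x \<le> R1"
  shows "summable (\<lambda>k. norm (opow x k \<cdot> a (Suc k)) / real (Suc k))" (is "summable ?T")
    and "(\<Sum>k. norm (opow x k \<cdot> a (Suc k)) / real (Suc k)) \<le> 1"
proof -
  define A where "A = norm (a 1)"
  define r where "r = norm x"
  have coeff: "norm (a (Suc (Suc k))) \<le> 1 - A\<^sup>2" for k
    unfolding A_def using assms by (intro coefficient_bound) (auto simp: SRB_def)
  then have A: "A\<^sup>2 \<le> 1"
    using coeff[of 0] norm_ge_zero[of "a (Suc (Suc 0))"] by linarith
  have r: "0 \<le> r" "r \<le> R1"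
    using assms by (auto simp: r_def)
  let ?g = "\<lambda>k. r ^ Suc k / real (k + 2)"
  have T: "?T k = r ^ k * norm (a (Suc k)) / real (Suc k)" for k
    by (simp add: norm_omult norm_opow r_def)
  have le: "?T (Suc k) \<le> (1 - A\<^sup>2) * ?g k" for k
  proof -
    have "r ^ Suc k * norm (a (Suc (Suc k))) \<le> r ^ Suc k * (1 - A\<^sup>2)"
      using coeff r by (intro mult_left_mono) auto
    then have "r ^ Suc k * norm (a (Suc (Suc k))) / real (k + 2) \<le> r ^ Suc k * (1 - A\<^sup>2) / real (k + 2)"
      by (rule divide_right_mono) simp
    then show ?thesis
      unfolding T by (simp add: mult_ac)
  qed
  have sg: "summable (\<lambda>k. (1 - A\<^sup>2) * ?g k)"
    by (rule summable_mult[OF remainder_le_half(1)[OF r]])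
  have sT: "summable (\<lambda>k. ?T (Suc k))"
    using le by (intro summable_comparison_test'[OF sg, of 0]) auto
  then show *: "summable ?T"
    using summable_Suc_iff[of ?T] by blast
  have "suminf ?T = A + (\<Sum>k. ?T (Suc k))"
    using suminf_split_head[OF *] by (simp add: A_def)
  also have "(\<Sum>k. ?T (Suc k)) \<le> (\<Sum>k. (1 - A\<^sup>2) * ?g k)"
    by (rule suminf_le[OF le sT sg])
  also have "\<dots> = (1 - A\<^sup>2) * suminf ?g"
    by (rule suminf_mult[OF remainder_le_half(1)[OF r]])
  also have "\<dots> \<le> (1 - A\<^sup>2) * (1 / 2)"
    using A remainder_le_half(2)[OF r] by (intro mult_left_mono) auto
  \<comment> \<open>Completing the square. The value 1/2 is critical: A + (1 - A^2) S \<le> 1 for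
    all A in [0,1) means S \<le> 1/(1 + A), hence S \<le> 1/2.\<close>
  also have "A + (1 - A\<^sup>2) * (1 / 2) = 1 - (1 - A)\<^sup>2 / 2"
    by (simp add: power2_eq_square field_simps)
  also have "\<dots> \<le> 1"
    by simp
  finally show "suminf ?T \<le> 1"
    by simp
qed

section \<open>Extremal functions and sharpness\<close>

definition blaschke :: "real \<Rightarrow> complex \<Rightarrow> complex" where
  "blaschke c z = z * (of_real c - z) / (1 - of_real c * z)"

text \<open>The entry at k belongs to z^(k+1). The values come from (c - z)/(1 - c z) = c - (1 -
  c^2) z/(1 - c z).\<close>

definition blaschke_coeff :: "real \<Rightarrow> nat \<Rightarrow> real" where
  "blaschke_coeff c k = (case k of 0 \<Rightarrow> c | Suc m \<Rightarrow> - ((1 - c\<^sup>2) * c ^ m))"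

definition blaschke_fun :: "real \<Rightarrow> octonion \<Rightarrow> octonion" where
  "blaschke_fun c x = (\<Sum>k. opow x (Suc k) \<cdot> (blaschke_coeff c k *\<^sub>R oone))"

context
  fixes c :: real
  assumes c: "0 < c" "c < 1"
begin

lemma norm_scaled_less_one:
  fixes z :: complex
  assumes "norm z < 1"
  shows "norm (of_real c * z) < 1"
proof -
  have "c * norm z \<le> norm z"
    using c by (simp add: mult_left_le_one_le)
  then show ?thesis
    using assms c by (simp add: norm_mult)
qed

lemma blaschke_denominator_nonzero:
  fixes z :: complex
  assumes "norm z < 1"
  shows "1 - of_real c * z \<noteq> 0"
  using norm_scaled_less_one[OF assms] by auto

lemma blaschke_sums:
  assumes "norm z < 1"
  shows "(\<lambda>k. z ^ Suc k * of_real (blaschke_coeff c k)) sums blaschke c z"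
proof -
  let ?h = "\<lambda>k. z ^ Suc k * complex_of_real (blaschke_coeff c k)"
  have "(\<lambda>k. - (1 - of_real (c\<^sup>2)) * z\<^sup>2 * (of_real c * z) ^ k) sums
      (- (1 - of_real (c\<^sup>2)) * z\<^sup>2 * (1 / (1 - of_real c * z)))"
    by (intro sums_mult geometric_sums norm_scaled_less_one assms)
  moreover have "(\<lambda>k. - (1 - of_real (c\<^sup>2)) * z\<^sup>2 * (of_real c * z) ^ k) = (\<lambda>k. ?h (Suc k))"
    by (simp add: blaschke_coeff_def fun_eq_iff power_mult_distrib power2_eq_square algebra_simps)
  ultimately have "?h sums (- (1 - of_real (c\<^sup>2)) * z\<^sup>2 * (1 / (1 - of_real c * z)) + ?h 0)"
    by (intro sums_Suc) simp
  moreover have "- (1 - of_real (c\<^sup>2)) * z\<^sup>2 * (1 / (1 - of_real c * z)) + ?h 0 = blaschke c z"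
    using blaschke_denominator_nonzero[OF assms]
    by (simp add: blaschke_def blaschke_coeff_def field_simps power2_eq_square)
  ultimately show ?thesis
    by simp
qed

lemma norm_blaschke_le_one:
  assumes "norm z < 1"
  shows "norm (blaschke c z) \<le> 1"
proof -
  have "(norm (1 - of_real c * z))\<^sup>2 - (norm (of_real c - z))\<^sup>2 = (1 - c\<^sup>2) * (1 - (norm z)\<^sup>2)"
    unfolding cmod_power2 by (simp add: power2_eq_square algebra_simps)
  also have "\<dots> \<ge> 0"
    using c assms by (intro mult_nonneg_nonneg) (auto simp: power_le_one)
  finally have "norm (of_real c - z) \<le> norm (1 - of_real c * z)"
    by (intro power2_le_imp_le[of "norm (of_real c - z)"]) auto
  moreover have "norm (1 - of_real c * z) > 0"
    using blaschke_denominator_nonzero[OF assms] by simp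
  ultimately have "norm ((of_real c - z) / (1 - of_real c * z)) \<le> 1"
    by (simp add: norm_divide)
  then have "norm z * norm ((of_real c - z) / (1 - of_real c * z)) \<le> 1"
    using assms by (intro mult_le_one) auto
  then show ?thesis
    by (simp add: blaschke_def norm_mult norm_divide)
qed

text \<open>Real coefficients keep every term in the plane of \<open>I\<close>, so the complex
  series transfers through the bounded linear map \<open>slice I\<close>.\<close>

lemma blaschke_fun_sums:
  assumes I: "I \<in> imag_units" and z: "norm z < 1"
  shows "(\<lambda>k. opow (slice I z) (Suc k) \<cdot> (blaschke_coeff c k *\<^sub>R oone)) sums slice I (blaschke c z)"
proof -
  have "opow (slice I z) (Suc k) \<cdot> (blaschke_coeff c k *\<^sub>R oone)
      = slice I (z ^ Suc k * of_real (blaschke_coeff c k))" for k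
    using slice_mult[OF I, of "z ^ Suc k" "of_real (blaschke_coeff c k)" oone]
    unfolding opow_slice[OF I] by simp
  then show ?thesis
    using bounded_linear.sums[OF bounded_linear_slice blaschke_sums[OF z]] by simp
qed

lemma blaschke_fun_slice:
  "I \<in> imag_units \<Longrightarrow> norm z < 1 \<Longrightarrow> blaschke_fun c (slice I z) = slice I (blaschke c z)"
  unfolding blaschke_fun_def using blaschke_fun_sums by (rule sums_unique[symmetric])

lemma blaschke_fun_expansion:
  "has_expansion (blaschke_fun c) (\<lambda>k. blaschke_coeff c (k - 1) *\<^sub>R oone)"
  unfolding has_expansion_def
proof
  fix x assume x: "x \<in> unit_ball"
  obtain I z where "I \<in> imag_units" "x = slice I z"
    by (rule slice_exhaust)
  with x show "(\<lambda>k. opow x (Suc k) \<cdot> (blaschke_coeff c (Suc k - 1) *\<^sub>R oone)) sums blaschke_fun c x"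
    using blaschke_fun_sums[of I z] blaschke_fun_slice[of I z]
    by (simp add: unit_ball_def norm_slice)
qed

lemma blaschke_has_derivative:
  assumes "norm z < 1"
  shows "(blaschke c has_derivative (*) (((of_real c - 2 * z) * (1 - of_real c * z)
      + of_real c * (z * (of_real c - z))) / (1 - of_real c * z)\<^sup>2)) (at z)"
proof -
  have "(blaschke c has_field_derivative (((of_real c - 2 * z) * (1 - of_real c * z)
      + of_real c * (z * (of_real c - z))) / (1 - of_real c * z)\<^sup>2)) (at z)"
    unfolding blaschke_def using blaschke_denominator_nonzero[OF assms]
    by (auto intro!: derivative_eq_intros simp: power2_eq_square algebra_simps)
  then show ?thesis
    by (simp add: has_field_derivative_def)
qed

text \<open>The stem components are the real and imaginary parts of the complex function, as real
  multiples of \<open>oone\<close>. The Cauchy-Riemann equations hold because its derivative is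
  multiplication by the complex number \<open>D z\<close>.\<close>

lemma slice_regular_blaschke_fun: "slice_regular (blaschke_fun c)"
proof -
  define D where "D = (\<lambda>z :: complex. ((of_real c - 2 * z) * (1 - of_real c * z)
      + of_real c * (z * (of_real c - z))) / (1 - of_real c * z)\<^sup>2)"
  have deriv: "(blaschke c has_derivative (*) (D z)) (at z)" if "z \<in> unit_disc" for z
    using blaschke_has_derivative that by (simp add: D_def unit_disc_def)
  have contD: "continuous_on unit_disc D"
    unfolding D_def using blaschke_denominator_nonzero
    by (intro continuous_intros) (auto simp: unit_disc_def)
  have comp_deriv: "((\<lambda>z. L (blaschke c z) *\<^sub>R oone) has_derivative (\<lambda>v. L (D z * v) *\<^sub>R oone)) (at z)"
    if "bounded_linear L" "z \<in> unit_disc" for L :: "complex \<Rightarrow> real" and z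
    using bounded_linear.has_derivative[OF bounded_linear_scaleR_left
        bounded_linear.has_derivative[OF that(1) deriv[OF that(2)]]] .
  have C1: "C1_on (\<lambda>z. L (blaschke c z) *\<^sub>R oone) unit_disc" if L: "bounded_linear L" for L
  proof -
    \<comment> \<open>The derivative factors as the fixed map \<open>M\<close> after multiplication
      by \<open>D z\<close>, so its continuity in operator norm follows from that of
      \<open>D\<close>.\<close>
    define M where "M = Blinfun (\<lambda>w. L w *\<^sub>R oone)"
    have M: "blinfun_apply M = (\<lambda>w. L w *\<^sub>R oone)"
      unfolding M_def using L
      by (intro bounded_linear_Blinfun_apply bounded_linear_scaleR_const)
    have "continuous_on unit_disc (\<lambda>z. M o\<^sub>L blinfun_mult_right (D z))"
      by (intro continuous_intros contD
          bounded_linear.continuous_on[OF bounded_linear_blinfun_mult_right])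
    moreover have "((\<lambda>z. L (blaschke c z) *\<^sub>R oone) has_derivative
        blinfun_apply (M o\<^sub>L blinfun_mult_right (D z))) (at z)" if "z \<in> unit_disc" for z
    proof -
      have "blinfun_apply (M o\<^sub>L blinfun_mult_right (D z)) = (\<lambda>v. L (D z * v) *\<^sub>R oone)"
        by (simp add: fun_eq_iff M)
      then show ?thesis
        using comp_deriv[OF L that] by simp
    qed
    ultimately show ?thesis
      unfolding C1_on_def by (intro exI[of _ "\<lambda>z. M o\<^sub>L blinfun_mult_right (D z)"] conjI ballI)
  qed
  let ?F1 = "\<lambda>z. Re (blaschke c z) *\<^sub>R oone" and ?F2 = "\<lambda>z. Im (blaschke c z) *\<^sub>R oone"
  have "blaschke c (cnj z) = cnj (blaschke c z)" for z
    by (simp add: blaschke_def)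
  then have "stem_function ?F1 ?F2"
    by (simp add: stem_function_def)
  moreover have "induces ?F1 ?F2 (blaschke_fun c)"
    unfolding induces_def
  proof (intro ballI allI impI)
    fix I \<alpha> \<beta> assume "I \<in> imag_units" "Complex \<alpha> \<beta> \<in> unit_disc"
    then show "blaschke_fun c (\<alpha> *\<^sub>R oone + \<beta> *\<^sub>R I) = ?F1 (Complex \<alpha> \<beta>) + I \<cdot> ?F2 (Complex \<alpha> \<beta>)"
      using blaschke_fun_slice[of I "Complex \<alpha> \<beta>"]
      by (simp add: slice_def unit_disc_def omult.scaleR_right)
  qed
  moreover have "cauchy_riemann ?F1 ?F2"
    unfolding cauchy_riemann_def
  proof
    fix z assume z: "z \<in> unit_disc"
    have "frechet_derivative ?F1 (at z) = (\<lambda>v. Re (D z * v) *\<^sub>R oone)"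
      "frechet_derivative ?F2 (at z) = (\<lambda>v. Im (D z * v) *\<^sub>R oone)"
      by (rule frechet_derivative_at[symmetric, OF comp_deriv[OF bounded_linear_Re z]],
          rule frechet_derivative_at[symmetric, OF comp_deriv[OF bounded_linear_Im z]])
    then show "frechet_derivative ?F1 (at z) 1 = frechet_derivative ?F2 (at z) \<i> \<and>
        frechet_derivative ?F1 (at z) \<i> = - frechet_derivative ?F2 (at z) 1"
      by simp
  qed
  ultimately show ?thesis
    unfolding slice_regular_def
    by (intro exI[of _ ?F1] exI[of _ ?F2] conjI C1 bounded_linear_Re bounded_linear_Im)
qed

lemma blaschke_fun_SRB: "blaschke_fun c \<in> SRB"
proof -
  have "norm (blaschke_fun c x) \<le> 1" if x: "x \<in> unit_ball" for x
  proof -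
    obtain I z where "I \<in> imag_units" "x = slice I z"
      by (rule slice_exhaust)
    with x show ?thesis
      using blaschke_fun_slice[of I z] norm_blaschke_le_one[of z]
      by (simp add: unit_ball_def norm_slice)
  qed
  then show ?thesis
    using slice_regular_blaschke_fun by (simp add: SRB_def)
qed

lemma blaschke_Bohr_sums:
  assumes r: "norm x = r" "0 < r" "r < 1"
  shows "(\<lambda>k. norm (opow x k \<cdot> (blaschke_coeff c k *\<^sub>R oone)) / real (Suc k)) sums
    (c + (1 - c\<^sup>2) / c * ((- ln (1 - r * c) - r * c) / (r * c)))"
proof -
  let ?T = "\<lambda>k. norm (opow x k \<cdot> (blaschke_coeff c k *\<^sub>R oone)) / real (Suc k)"
  have c2: "c\<^sup>2 \<le> 1"
    using c by (simp add: power_le_one)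
  have rc: "0 < r * c" "r * c < 1"
    using c r mult_strict_mono[of r 1 c 1] by auto
  \<comment> \<open>Pulling out 1/c matches the exponents of r and c, so the tail is the remainder
    series at r c.\<close>
  have "(\<lambda>k. (1 - c\<^sup>2) / c * ((r * c) ^ Suc k / real (k + 2))) sums
    ((1 - c\<^sup>2) / c * ((- ln (1 - r * c) - r * c) / (r * c)))"
    by (intro sums_mult log_remainder_sums rc)
  moreover have "(1 - c\<^sup>2) / c * ((r * c) ^ Suc k / real (k + 2)) = ?T (Suc k)" for k
    using c c2 r by (simp add: norm_omult norm_opow blaschke_coeff_def abs_mult power_mult_distrib)
  ultimately have "(\<lambda>k. ?T (Suc k)) sums ((1 - c\<^sup>2) / c * ((- ln (1 - r * c) - r * c) / (r * c)))"
    by simp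
  from sums_Suc[OF this] show ?thesis
    using c by (simp add: blaschke_coeff_def add.commute)
qed

end

lemma R1_sharp:
  assumes "R1 < r" "r < 1"
  shows "\<exists>f a. f \<in> SRB \<and> has_expansion f a \<and> (\<forall>x. norm x = r \<longrightarrow>
    summable (\<lambda>k. norm (opow x k \<cdot> a (Suc k)) / real (Suc k)) \<and>
    (\<Sum>k. norm (opow x k \<cdot> a (Suc k)) / real (Suc k)) > 1)"
proof -
  \<comment> \<open>This choice makes r c = R1, where the remainder is exactly 1/2; since c < 1, the
    excess over 1 is (1 - c)^2/(2 c) > 0.\<close>
  define c where "c = R1 / r"
  have R1: "0 < R1" "(- ln (1 - R1) - R1) / R1 = 1 / 2"
    using is_R1_R1 by (auto simp: is_R1_iff)
  have c: "0 < c" "c < 1" "r * c = R1"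
    using R1(1) assms by (auto simp: c_def)
  have "c + (1 - c\<^sup>2) / c * (1 / 2) - 1 = (1 - c)\<^sup>2 / (2 * c)"
    using c by (simp add: field_simps power2_eq_square)
  also have "\<dots> > 0"
    using c by simp
  finally have gt: "1 < c + (1 - c\<^sup>2) / c * (1 / 2)"
    by simp
  have "summable (\<lambda>k. norm (opow x k \<cdot> (blaschke_coeff c k *\<^sub>R oone)) / real (Suc k)) \<and>
      (\<Sum>k. norm (opow x k \<cdot> (blaschke_coeff c k *\<^sub>R oone)) / real (Suc k)) > 1" if "norm x = r" for x
    using blaschke_Bohr_sums[OF c(1,2) that] R1 assms gt unfolding c(3) R1(2) sums_iff by simp
  then show ?thesis
    using blaschke_fun_SRB[OF c(1,2)] blaschke_fun_expansion[OF c(1,2)]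
    by (intro exI[of _ "blaschke_fun c"] exI[of _ "\<lambda>k. blaschke_coeff c (k - 1) *\<^sub>R oone"]) simp
qed

theorem corollary2p3:
  "(\<exists>!y. is_R1 y) \<and> 0.5828 \<le> R1 \<and> R1 < 0.5829 \<and>
   (\<forall>f a x. f \<in> SRB \<and> has_expansion f a \<and> x \<in> unit_ball \<and> norm x \<le> R1 \<longrightarrow>
      summable (\<lambda>k. norm (opow x k \<cdot> a (Suc k)) / real (Suc k)) \<and>
      (\<Sum>k. norm (opow x k \<cdot> a (Suc k)) / real (Suc k)) \<le> 1) \<and>
   (\<forall>r. R1 < r \<and> r < 1 \<longrightarrow>
      (\<exists>f a. f \<in> SRB \<and> has_expansion f a \<and>
         (\<forall>x. norm x = r \<longrightarrow>
            summable (\<lambda>k. norm (opow x k \<cdot> a (Suc k)) / real (Suc k)) \<and>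
            (\<Sum>k. norm (opow x k \<cdot> a (Suc k)) / real (Suc k)) > 1)))"
proof (intro conjI allI impI)
  show "\<exists>!y. is_R1 y"
    using is_R1_R1 is_R1_unique by blast
  show "0.5828 \<le> R1" "R1 < 0.5829"
    using R1_bounds by auto
next
  fix f a x
  assume "f \<in> SRB \<and> has_expansion f a \<and> x \<in> unit_ball \<and> norm x \<le> R1"
  then have "f \<in> SRB" "has_expansion f a" "norm x \<le> R1"
    by auto
  then show "summable (\<lambda>k. norm (opow x k \<cdot> a (Suc k)) / real (Suc k))"
    "(\<Sum>k. norm (opow x k \<cdot> a (Suc k)) / real (Suc k)) \<le> 1"
    by (rule Bohr_sum_le_one)+
next
  fix r
  assume "R1 < r \<and> r < 1"
  then show "\<exists>f a. f \<in> SRB \<and> has_expansion f a \<and> (\<forall>x. norm x = r \<longrightarrow>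
      summable (\<lambda>k. norm (opow x k \<cdot> a (Suc k)) / real (Suc k)) \<and>
      (\<Sum>k. norm (opow x k \<cdot> a (Suc k)) / real (Suc k)) > 1)"
    by (intro R1_sharp) auto
qed

end
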